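(* Let $m\ge2$ and let $s$ be an integer with $1<s<m$ and $\gcd(s,m)=1$. Then \[ E(m,s)\le \frac{s}{\ln s}\ln(m)+s-1 . \]
   Context: An expression is a formal term built from the symbol $x$ using the binary operations $+$ and $\cdot$ (with parentheses); its size is the number of occurrences of $x$ in it. For $m\ge2$ and a unit $s\in\mathbb{Z}/m\mathbb{Z}$ (the base), the complexity $||a||_s$ of $a\in\mathbb{Z}/m\mathbb{Z}$ is the minimum size of an expression that evaluates to $a$ in $\mathbb{Z}/m\mathbb{Z}$ when $x=s$ (every element of $\mathbb{Z}/m\mathbb{Z}$ is the value of some expression when $s$ is a unit). The inefficiency of $s$ is $E(m,s)=\max_{a\in\mathbb{Z}/m\mathbb{Z}}||a||_s$. The integer $s$ is identified with its residue class mod $m$. *)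

theory Defs
  imports Complex_Main "HOL-Number_Theory.Residues"
begin

datatype expression = X | Plus expression expression | Times expression expression

fun occurrences :: "expression \<Rightarrow> nat" where
  "occurrences X = 1"
| "occurrences (Plus e f) = occurrences e + occurrences f"
| "occurrences (Times e f) = occurrences e + occurrences f"

fun evaluate :: "('a, 'b) ring_scheme \<Rightarrow> 'a \<Rightarrow> expression \<Rightarrow> 'a" where
  "evaluate R s X = s"
| "evaluate R s (Plus e f) = evaluate R s e \<oplus>\<^bsub>R\<^esub> evaluate R s f"
| "evaluate R s (Times e f) = evaluate R s e \<otimes>\<^bsub>R\<^esub> evaluate R s f"

(* Meaningful only if some expression evaluates to a; over residue_ring m this
   holds for every element a of the carrier as soon as the base s is a unit. *)
definition complexity :: "('a, 'b) ring_scheme \<Rightarrow> 'a \<Rightarrow> 'a \<Rightarrow> nat" where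
  "complexity R s a = (LEAST n. \<exists>e. evaluate R s e = a \<and> occurrences e = n)"

(* residue_ring m has carrier {0..m - 1}, so s mod m is the residue class of s. *)
definition inefficiency :: "int \<Rightarrow> int \<Rightarrow> nat" where
  "inefficiency m s =
     Max (complexity (residue_ring m) (s mod m) ` carrier (residue_ring m))"

end

theory Submission imports Defs
begin

text \<open>Since \<open>s\<close> is a unit, every residue class contains \<open>s n\<close> for some \<open>1 \<le> n \<le> m\<close>.
  If \<open>n\<close> has \<open>k + 1\<close> digits in base \<open>s\<close>, then evaluating \<open>s n\<close> by Horner's scheme costs at most
  \<open>s - 1\<close> copies of \<open>x\<close> per digit, and one more for each of the \<open>k\<close> multiplications
  by \<open>x\<close>; altogether at most \<open>s (k + 1) - 1\<close>, where \<open>s ^ k \<le> n \<le> m\<close>.\<close>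

lemma occurrences_funpow_Plus_X:
  "occurrences ((Plus X ^^ d) e) = d + occurrences e"
  by (induction d) auto

text \<open>Allowing any integer representative \<open>z\<close> lets Horner's scheme be computed
  over the integers, with a single reduction mod \<open>m\<close>.\<close>

lemma evaluate_funpow_Plus_X:
  assumes "evaluate (residue_ring m) (s mod m) e = z mod m"
  shows "evaluate (residue_ring m) (s mod m) ((Plus X ^^ d) e) = (int d * s + z) mod m"
  using assms
  by (induction d) (auto simp: residue_ring_def mod_simps algebra_simps)

lemma evaluate_Times_X:
  assumes "evaluate (residue_ring m) (s mod m) e = z mod m"
  shows "evaluate (residue_ring m) (s mod m) (Times X e) = (s * z) mod m"
  using assms by (simp add: residue_ring_def mod_simps)

lemma complexity_le:
  assumes "evaluate R s e = a"
  shows "complexity R s a \<le> occurrences e"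
  unfolding complexity_def using assms by (intro Least_le) auto

text \<open>Strong induction strips the last digit: \<open>n = s * q + d\<close> gives s n = s (s q)
  + d s. The extra factor \<open>s\<close> is there because every summand \<open>X\<close>
  contributes \<open>s\<close>, not 1. The \<open>+ 1\<close> on the left avoids subtraction in
  \<open>nat\<close>.\<close>

lemma horner_expression:
  fixes s n :: nat and m :: int
  assumes "s > 1" "n > 0"
  shows "\<exists>e k. evaluate (residue_ring m) (int s mod m) e = (int s * int n) mod m
    \<and> occurrences e + 1 \<le> s * (k + 1) \<and> s ^ k \<le> n"
  using assms(2)
proof (induction n rule: less_induct)
  case (less n)
  show ?case
  proof (cases "n < s")
    case True
    \<comment> \<open>There is no empty expression to start from, so the leading digit begins with
      \<open>X\<close> itself and only \<open>n - 1\<close> copies are added.\<close>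
    define e where "e = (Plus X ^^ (n - 1)) X"
    have "evaluate (residue_ring m) (int s mod m) e
        = (int (n - 1) * int s + int s) mod m"
      unfolding e_def by (rule evaluate_funpow_Plus_X) simp
    also have "int (n - 1) * int s + int s = int s * int n"
      using less.prems by (simp add: of_nat_diff algebra_simps)
    finally have "evaluate (residue_ring m) (int s mod m) e = (int s * int n) mod m" .
    moreover have "occurrences e + 1 \<le> s * (0 + 1)"
      using True less.prems by (simp add: e_def occurrences_funpow_Plus_X)
    moreover have "s ^ 0 \<le> n" using less.prems by simp
    ultimately show ?thesis by blast
  next
    case False
    define q d where "q = n div s" and "d = n mod s"
    have n: "n = s * q + d" by (simp add: q_def d_def)
    have "q < n" "q > 0" "d < s"
      using False assms less.prems by (auto simp: q_def d_def div_greater_zero_iff)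
    then obtain e k where e: "evaluate (residue_ring m) (int s mod m) e = (int s * int q) mod m"
      and occ: "occurrences e + 1 \<le> s * (k + 1)" and k: "s ^ k \<le> q"
      using less.IH by blast
    define f where "f = (Plus X ^^ d) (Times X e)"
    have "evaluate (residue_ring m) (int s mod m) f
        = (int d * int s + int s * (int s * int q)) mod m"
      unfolding f_def by (intro evaluate_funpow_Plus_X evaluate_Times_X e)
    also have "int d * int s + int s * (int s * int q) = int s * int n"
      by (simp add: n algebra_simps)
    finally have "evaluate (residue_ring m) (int s mod m) f = (int s * int n) mod m" .
    \<comment> \<open>The new digit costs \<open>d\<close> additions and one multiplication; d + 1
      \<le> s is exactly what raising \<open>k\<close> by one allows.\<close>
    moreover have "occurrences f + 1 \<le> s * (Suc k + 1)"
      using occ \<open>d < s\<close> by (simp add: f_def occurrences_funpow_Plus_X)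
    moreover have "s ^ Suc k \<le> n"
      using mult_le_mono2[OF k, of s] unfolding n by (simp only: power_Suc trans_le_add1)
    ultimately show ?thesis by blast
  qed
qed

text \<open>Multiply \<open>a\<close> by an inverse of \<open>s\<close>. Positivity is what
  \<open>horner_expression\<close> demands of \<open>n\<close>, and the bound \<open>m\<close> is
  what limits the number of digits.\<close>

lemma unit_multiple_representative:
  fixes m s a :: int
  assumes "m > 0" "coprime s m"
  obtains n where "0 < n" "n \<le> m" "[s * n = a] (mod m)"
proof -
  obtain t where t: "[s * t = 1] (mod m)"
    using cong_solve_coprime_int assms(2) by blast
  \<comment> \<open>The shift by one picks the representative in \<open>{1..m}\<close> instead of \<open>{0..<m}\<close>.\<close>
  define n where "n = (t * a - 1) mod m + 1"
  have "[n = (t * a - 1) + 1] (mod m)"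
    unfolding n_def by (intro cong_add) (auto simp: cong_def)
  then have "[s * n = s * (t * a)] (mod m)"
    by (intro cong_scalar_left) simp
  also have "[s * (t * a) = 1 * a] (mod m)"
    using cong_scalar_right[OF t, of a] by (simp add: mult.assoc)
  finally have "[s * n = a] (mod m)" by simp
  moreover have "0 < n" "n \<le> m"
    using pos_mod_bound[OF assms(1), of "t * a - 1"] pos_mod_sign[OF assms(1), of "t * a - 1"]
    by (simp_all add: n_def)
  ultimately show ?thesis using that by blast
qed

lemma complexity_bound:
  fixes m s a :: int
  assumes "m \<ge> 2" "1 < s" "coprime s m" "a \<in> carrier (residue_ring m)"
  shows "real (complexity (residue_ring m) (s mod m) a)
    \<le> real_of_int s / ln (real_of_int s) * ln (real_of_int m) + real_of_int s - 1"
proof -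
  obtain n where n: "0 < n" "n \<le> m" "[s * n = a] (mod m)"
    using unit_multiple_representative[of m s a] assms by auto
  obtain e k where e: "evaluate (residue_ring m) (int (nat s) mod m) e
        = (int (nat s) * int (nat n)) mod m"
    and occ: "occurrences e + 1 \<le> nat s * (k + 1)" and k: "nat s ^ k \<le> nat n"
    using horner_expression[of "nat s" "nat n" m] assms n by auto
  have "a mod m = a" using assms by (simp add: residue_ring_def)
  with e n assms have "evaluate (residue_ring m) (s mod m) e = a"
    by (simp add: cong_def)
  then have "real (complexity (residue_ring m) (s mod m) a) \<le> real (occurrences e)"
    by (simp add: complexity_le)
  also have "\<dots> \<le> real_of_int s * (real k + 1) - 1"
  proof -
    have "real (occurrences e + 1) \<le> real (nat s * (k + 1))"
      using occ by (simp only: of_nat_le_iff)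
    then show ?thesis using assms by (simp add: algebra_simps)
  qed
  \<comment> \<open>Taking logarithms in s^k \<le> n \<le> m bounds \<open>k\<close> by the
    base-\<open>s\<close> logarithm of \<open>m\<close>.\<close>
  also have "\<dots> \<le> real_of_int s * (ln (real_of_int m) / ln (real_of_int s) + 1) - 1"
  proof -
    have "real (nat s ^ k) \<le> real (nat n)" using k by (simp only: of_nat_le_iff)
    then have "real_of_int s ^ k \<le> real_of_int m"
      using n assms by simp
    then have "ln (real_of_int s ^ k) \<le> ln (real_of_int m)"
      using assms by (intro ln_mono) auto
    then have "real k \<le> ln (real_of_int m) / ln (real_of_int s)"
      using assms by (simp add: ln_realpow pos_le_divide_eq)
    then show ?thesis using assms by simp
  qed
  finally show ?thesis by (simp add: algebra_simps)
qed

theorem theorem4p6: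
  fixes m s :: int
  assumes "m \<ge> 2" and "1 < s" and "s < m" and "gcd s m = 1"
  shows "real (inefficiency m s)
    \<le> real_of_int s / ln (real_of_int s) * ln (real_of_int m) + real_of_int s - 1"
proof -
  let ?C = "complexity (residue_ring m) (s mod m) ` carrier (residue_ring m)"
  have "finite ?C" "?C \<noteq> {}" using assms(1) by (auto simp: residue_ring_def)
  then have "Max ?C \<in> ?C" by (rule Max_in)
  then show ?thesis
    using complexity_bound[of m s] assms
    unfolding inefficiency_def by (auto simp: coprime_iff_gcd_eq_1)
qed

end
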